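(* Let $p$ be an odd prime, $n\ge1$, $k\ge1$ integers, let $F(x)=x^{p^k+1}$ on $\mathbb{F}_{p^n}$, and let $e=\gcd(k,n)$, $r=n/e$. For $u\in\mathbb{F}_{p^n}^*$ define the $\mathbb{F}_p$-linear map $\ell_u:\mathbb{F}_{p^n}\to\mathbb{F}_{p^n}$, $\ell_u(x)=ux^{p^k}+u^{p^k}x$, and $$(\operatorname{Im}\ell_u)^\perp=\{z\in\mathbb{F}_{p^n}:\mathrm{Tr}_1^n(zw)=0\text{ for every }w\in\operatorname{Im}\ell_u\}.$$ Then, for every $(u,v)\in(\mathbb{F}_{p^n}^* )^2$, the following hold. (i) If $r$ is odd, then $\mathcal{L}_F(u,v)=(0,\ldots,0)$. (ii) If $r$ is even, then, for every $j\in\mathbb{F}_p$, $$L_F(u,v;j)=\begin{cases}(p-1)p^{n-1},&\text{if }v\in(\operatorname{Im}\ell_u)^\perp\text{ and }j=\mathrm{Tr}_1^n(vu^{p^k+1}),\\-p^{n-1},&\text{if }v\in(\operatorname{Im}\ell_u)^\perp\text{ and }j\ne\mathrm{Tr}_1^n(vu^{p^k+1}),\\0,&\text{if }v\notin(\operatorname{Im}\ell_u)^\perp.\end{cases}$$ Moreover, in the even case, among the $(p^n-1)^2$ pairs $(u,v)\in(\mathbb{F}_{p^n}^* )^2$, the profile $\mathcal{L}_F(u,v)$ is the zero vector for $(p^n-1)(p^n-p^e)$ pairs, and for each of the remaining $(p^n-1)(p^e-1)$ pairs it is a permutation of $$\bigl((p-1)p^{n-1},\underbrace{-p^{n-1}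,\ldots,-p^{n-1}}_{p-1}\bigr).$$
   Context: $\mathrm{Tr}_1^n$ is the absolute trace $\mathbb{F}_{p^n}\to\mathbb{F}_p$; $\mathbb{F}_{p^n}^*=\mathbb{F}_{p^n}\setminus\{0\}$. The derivative is $D_uF(x)=F(x+u)-F(x)$. The profile is $\mathcal{L}_F(u,v)=(L_F(u,v;j))_{j\in\mathbb{F}_p}$, where $L_F(u,v;j)=\#\{x\in\mathbb{F}_{p^n}:\mathrm{Tr}_1^n(vD_uF(x))=j\}-p^{n-1}$. *)

theory Defs
  imports "HOL-Number_Theory.Residues" "HOL-Computational_Algebra.Computational_Algebra"
    "HOL-Combinatorics.List_Permutation" "HOL-Library.Cardinality"
begin

text \<open>
  The field with \<open>p ^ n\<close> elements is a type \<open>'a :: finite_field\<close> with \<open>CARD('a) = p ^ n\<close>.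
  Its prime subfield \<open>prime_subfield\<close> is the copy of the field with \<open>p\<close> elements inside
  \<open>'a\<close>, so traces and the index \<open>j\<close> of a profile are elements of \<open>'a\<close>.
  The arguments \<open>p\<close> and \<open>n\<close> of the constants below are meant to satisfy this equation.
\<close>

definition prime_subfield :: "'a :: finite_field set" where
  "prime_subfield = range of_nat"

definition abs_trace :: "nat \<Rightarrow> nat \<Rightarrow> 'a :: finite_field \<Rightarrow> 'a" where
  "abs_trace p n x = (\<Sum>i<n. x ^ (p ^ i))"

definition derivative :: "'a :: finite_field \<Rightarrow> ('a \<Rightarrow> 'a) \<Rightarrow> 'a \<Rightarrow> 'a" where
  "derivative u F x = F (x + u) - F x"

definition profile_entry ::
  "nat \<Rightarrow> nat \<Rightarrow> ('a :: finite_field \<Rightarrow> 'a) \<Rightarrow> 'a \<Rightarrow> 'a \<Rightarrow> 'a \<Rightarrow> int" where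
  "profile_entry p n F u v j =
     int (card {x. abs_trace p n (v * derivative u F x) = j}) - int (p ^ (n - 1))"

text \<open>
  The profile is the vector of its entries, with \<open>j\<close> running through the prime subfield in the
  order \<open>0, 1, \<dots>, p - 1\<close>.
\<close>

definition profile ::
  "nat \<Rightarrow> nat \<Rightarrow> ('a :: finite_field \<Rightarrow> 'a) \<Rightarrow> 'a \<Rightarrow> 'a \<Rightarrow> int list" where
  "profile p n F u v = map (\<lambda>i. profile_entry p n F u v (of_nat i)) [0..<p]"

definition ell :: "nat \<Rightarrow> nat \<Rightarrow> 'a :: finite_field \<Rightarrow> 'a \<Rightarrow> 'a" where
  "ell p k u x = u * x ^ (p ^ k) + u ^ (p ^ k) * x"

definition trace_perp :: "nat \<Rightarrow> nat \<Rightarrow> 'a :: finite_field set \<Rightarrow> 'a set" where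
  "trace_perp p n W = {z. \<forall>w\<in>W. abs_trace p n (z * w) = 0}"


lemma CHAR_eq_prime:
  assumes "prime p" and "CARD('a :: finite_field) = p ^ n"
  shows "CHAR('a) = p"
proof -
  have "CHAR('a) dvd p ^ n"
    using CHAR_dvd_CARD[where 'a = 'a] assms(2) by simp
  then have "CHAR('a) dvd p"
    using prime_dvd_power CHAR_prime[where 'a = 'a] by blast
  then show ?thesis
    using primes_dvd_imp_eq[OF CHAR_prime[where 'a = 'a] assms(1)] by blast
qed

lemma bij_betw_of_nat_prime_subfield:
  assumes "prime p" and "CARD('a :: finite_field) = p ^ n"
  shows "bij_betw of_nat {..<p} (prime_subfield :: 'a set)"
proof -
  have ch: "CHAR('a) = p" by (rule CHAR_eq_prime[OF assms])
  have p0: "p > 0" using assms(1) prime_gt_0_nat by blast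
  have "inj_on (of_nat :: nat \<Rightarrow> 'a) {..<p}"
    by (rule inj_onI) (auto simp: of_nat_eq_iff_cong_CHAR ch cong_def)
  moreover have "(of_nat m :: 'a) \<in> of_nat ` {..<p}" for m
    by (rule image_eqI[of _ _ "m mod p"])
      (use p0 in \<open>auto simp: of_nat_eq_iff_cong_CHAR ch cong_def\<close>)
  ultimately show ?thesis
    by (auto simp: bij_betw_def prime_subfield_def)
qed

lemma power_prime_power_of_nat:
  assumes "CHAR('a :: finite_field) = p"
  shows "(of_nat m :: 'a) ^ (p ^ i) = of_nat m"
proof -
  have pr: "prime CHAR('a)" by simp
  have *: "(of_nat m :: 'a) ^ p = of_nat m" for m
  proof (induction m)
    case 0
    then show ?case using pr assms prime_gt_0_nat by (simp add: power_0_left)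
  next
    case (Suc m)
    then show ?case using freshmans_dream[OF pr, of p 1 "of_nat m"] assms by simp
  qed
  show ?thesis by (induction i) (simp_all add: power_mult *)
qed

lemma prime_subfield_iff:
  assumes "prime p" and "CARD('a :: finite_field) = p ^ n"
  shows "(x :: 'a) \<in> prime_subfield \<longleftrightarrow> x ^ p = x"
proof -
  have ch: "CHAR('a) = p" by (rule CHAR_eq_prime[OF assms])
  have p1: "p > 1" using assms(1) prime_gt_1_nat by blast
  define q where "q = monom (1 :: 'a) p - monom 1 1"
  have c: "coeff q p = 1" using p1 by (simp add: q_def)
  then have q0: "q \<noteq> 0" by auto
  have "degree q \<le> p"
    unfolding q_def by (rule degree_diff_le) (use p1 in \<open>auto simp: degree_monom_eq\<close>)
  then have "card {x. poly q x = 0} \<le> p"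
    using card_poly_roots_bound[OF q0] by simp
  moreover have "{x. poly q x = 0} = {x :: 'a. x ^ p = x}"
    by (simp add: q_def poly_monom)
  moreover have "(prime_subfield :: 'a set) \<subseteq> {x. x ^ p = x}"
    using power_prime_power_of_nat[OF ch, of _ 1] by (auto simp: prime_subfield_def)
  moreover have "card (prime_subfield :: 'a set) = p"
    using bij_betw_same_card[OF bij_betw_of_nat_prime_subfield[OF assms]] by simp
  ultimately have "(prime_subfield :: 'a set) = {x. x ^ p = x}"
    by (intro card_seteq) auto
  then show ?thesis by auto
qed

lemma abs_trace_in_prime_subfield:
  assumes "prime p" and "CARD('a :: finite_field) = p ^ n"
  shows "abs_trace p n (x :: 'a) \<in> prime_subfield"
proof -
  have ch: "CHAR('a) = p" by (rule CHAR_eq_prime[OF assms])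
  have pr: "prime CHAR('a)" by simp
  have "abs_trace p n x ^ p = (\<Sum>i<n. x ^ (p ^ Suc i))"
    unfolding abs_trace_def
    by (subst freshmans_dream_sum[OF pr]) (simp_all add: ch mult.commute flip: power_mult)
  moreover have "(\<Sum>i<n. x ^ (p ^ Suc i)) + x ^ (p ^ 0) = abs_trace p n x + x ^ (p ^ n)"
    unfolding abs_trace_def
    using sum.lessThan_Suc_shift[of "\<lambda>i. x ^ (p ^ i)" n] sum.lessThan_Suc[of "\<lambda>i. x ^ (p ^ i)" n]
    by (simp add: add.commute)
  moreover have "x ^ (p ^ n) = x"
    using finite_field_power_card_eq_same[of x] assms(2) by simp
  ultimately show ?thesis
    by (simp add: prime_subfield_iff[OF assms])
qed

lemma ell_linear:
  assumes "prime p" and "CARD('a :: finite_field) = p ^ n"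
  shows "ell p k u (x + y) = ell p k u x + ell p k u (y :: 'a)"
    and "c \<in> prime_subfield \<Longrightarrow> ell p k u (c * x) = c * ell p k u (x :: 'a)"
proof -
  have ch: "CHAR('a) = p" by (rule CHAR_eq_prime[OF assms])
  have pr: "prime CHAR('a)" by simp
  show "ell p k u (x + y) = ell p k u x + ell p k u y"
    using freshmans_dream'[OF pr, of "p ^ k" k x y] ch by (simp add: ell_def algebra_simps)
  show "ell p k u (c * x) = c * ell p k u x" if "c \<in> prime_subfield"
    using that power_prime_power_of_nat[OF ch, of _ k]
    by (auto simp: ell_def prime_subfield_def power_mult_distrib algebra_simps)
qed

end

theory Submission
  imports Defs
begin

text \<open>
  Since \<open>D\<^sub>u F (x) = ell_u(x) + u ^ (p ^ k + 1)\<close>, the profile describes the fibres of the additive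
  map \<open>x \<mapsto> Tr (v ell_u(x))\<close>, which is either zero, namely for \<open>v\<close> in the orthogonal
  complement, or takes each value in the prime field equally often. With \<open>w = v u ^ (p ^ k + 1)\<close>,
  nondegeneracy of the trace turns the first case into \<open>w ^ (p ^ k) = - w\<close>. Iterating this \<open>r\<close>
  times gives \<open>w = - w\<close> for odd \<open>r\<close>. For even \<open>r\<close> it is equivalent, by Bezout, to
  \<open>w ^ (p ^ e) = - w\<close>, which has \<open>p ^ e\<close> solutions.
\<close>

section \<open>Fibres of additive maps, roots of linearized polynomials, iterated signs\<close>

lemma additive_minus:
  fixes f :: "'a :: ab_group_add \<Rightarrow> 'b :: ab_group_add"
  assumes "\<And>x y. f (x + y) = f x + f y"
  shows "f (x - y) = f x - f y"
  using assms[of "x - y" y] by (simp add: algebra_simps)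

text \<open>Translation by a preimage of \<open>c\<close> carries the kernel onto the fibre.\<close>

lemma card_fiber_additive:
  fixes f :: "'a :: ab_group_add \<Rightarrow> 'b :: ab_group_add"
  assumes add: "\<And>x y. f (x + y) = f x + f y" and c: "c \<in> range f"
  shows "card {x. f x = c} = card {x. f x = 0}"
proof -
  obtain a where a: "f a = c" using c by auto
  have "bij_betw (\<lambda>x. x + a) {x. f x = 0} {x. f x = c}"
    by (rule bij_betw_byWitness[where f' = "\<lambda>x. x - a"])
      (auto simp: add a additive_minus[of f, OF add])
  then show ?thesis by (simp add: bij_betw_same_card)
qed

text \<open>Counting form of the first isomorphism theorem: the domain is partitioned into fibres,
  all as large as the kernel.\<close>

lemma card_range_kernel_additive:
  fixes f :: "'a :: {ab_group_add, finite} \<Rightarrow> 'b :: ab_group_add"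
  assumes add: "\<And>x y. f (x + y) = f x + f y"
  shows "CARD('a) = card (range f) * card {x. f x = 0}"
proof -
  have "CARD('a) = card (\<Union>c\<in>range f. {x. f x = c})"
    by (rule arg_cong[of _ _ card]) auto
  also have "\<dots> = (\<Sum>c\<in>range f. card {x. f x = c})"
    by (rule card_UN_disjoint) auto
  also have "\<dots> = (\<Sum>c\<in>range f. card {x. f x = 0})"
    by (rule sum.cong) (auto intro: card_fiber_additive[of f, OF add])
  finally show ?thesis by simp
qed

text \<open>The sum is the value of a polynomial of degree at most \<open>Q ^ m\<close>. Since
  \<open>Q \<ge> 2\<close>, its exponents are distinct, so the coefficient at \<open>Q ^ m\<close>
  is \<open>c m\<close> and the polynomial is nonzero.\<close>

lemma card_roots_linearized:
  fixes c :: "nat \<Rightarrow> 'a :: idom"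
  assumes Q: "Q \<ge> 2" and c: "c m \<noteq> 0"
  shows "card {x. (\<Sum>i\<le>m. c i * x ^ (Q ^ i)) = 0} \<le> Q ^ m"
proof -
  define P where "P = (\<Sum>i\<le>m. monom (c i) (Q ^ i))"
  have "coeff P (Q ^ m) = (\<Sum>i\<le>m. if i = m then c i else 0)"
    using Q by (simp add: P_def coeff_sum)
  then have P0: "P \<noteq> 0" using c by auto
  have "degree P \<le> Q ^ m"
    unfolding P_def
    using Q by (intro degree_sum_le)
      (auto intro!: order_trans[OF degree_monom_le] power_increasing)
  moreover have "{x. poly P x = 0} = {x. (\<Sum>i\<le>m. c i * x ^ (Q ^ i)) = 0}"
    by (simp add: P_def poly_sum poly_monom)
  ultimately show ?thesis
    using card_poly_roots_bound[OF P0] by simp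
qed

text \<open>For odd \<open>Q\<close> the sign survives taking \<open>Q\<close>-th powers, so every
  further iteration contributes one factor \<open>- 1\<close>.\<close>

lemma power_iterate_minus:
  fixes w :: "'a :: comm_ring_1"
  assumes "odd Q" and w: "w ^ Q = - w"
  shows "w ^ (Q ^ i) = (- 1) ^ i * w"
proof (induction i)
  case (Suc i)
  have "w ^ (Q ^ Suc i) = (w ^ (Q ^ i)) ^ Q"
    by (simp add: mult.commute flip: power_mult)
  also have "\<dots> = ((- 1) ^ Q) ^ i * w ^ Q"
    by (simp only: Suc.IH power_mult_distrib mult.commute flip: power_mult)
  finally show ?case using assms by simp
qed simp

section \<open>Frobenius, trace and additive maps into the prime subfield\<close>

context
  fixes p n :: nat
  assumes prime_p: "prime p" and card_UNIV: "CARD('a :: finite_field) = p ^ n"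
begin

lemma frobenius_add: "((x :: 'a) + y) ^ (p ^ i) = x ^ (p ^ i) + y ^ (p ^ i)"
  using freshmans_dream'[OF CHAR_prime[where 'a = 'a], of "p ^ i" i x y] CHAR_eq_prime[OF prime_p card_UNIV] by simp

text \<open>Iterates \<open>x ^ (p ^ n) = x\<close>, so that Frobenius exponents may be reduced
  modulo \<open>n\<close>.\<close>

lemma power_card_power_same: "(x :: 'a) ^ (p ^ (n * b)) = x"
proof (induction b)
  case (Suc b)
  have "x ^ (p ^ (n * Suc b)) = (x ^ (p ^ n)) ^ (p ^ (n * b))"
    by (simp add: power_add flip: power_mult)
  then show ?case
    using Suc finite_field_power_card_eq_same[of x] card_UNIV by simp
qed simp

lemma n_pos: "n > 0"
proof (rule ccontr)
  assume "\<not> n > 0"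
  then have "CARD('a) = 1" using card_UNIV by simp
  then have "(0 :: 'a) = 1" by (metis UNIV_I card_1_singletonE singletonD)
  then show False by simp
qed

lemma surj_frobenius: "surj (\<lambda>x :: 'a. x ^ (p ^ k))"
proof -
  have "inj (\<lambda>x :: 'a. x ^ (p ^ k))"
  proof (rule injI)
    fix x y :: 'a
    assume eq: "x ^ (p ^ k) = y ^ (p ^ k)"
    have "(x - y) ^ (p ^ k) = 0"
      using additive_minus[of "\<lambda>x :: 'a. x ^ (p ^ k)", OF frobenius_add] eq by simp
    then show "x = y" by simp
  qed
  then show ?thesis by (simp add: finite_UNIV_inj_surj)
qed

lemma abs_trace_add: "abs_trace p n ((x :: 'a) + y) = abs_trace p n x + abs_trace p n y"
  by (simp add: abs_trace_def frobenius_add sum.distrib)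

text \<open>One Frobenius step turns the trace into its \<open>p\<close>-th power, which is the
  trace again because the trace lies in the prime subfield.\<close>

lemma abs_trace_frobenius: "abs_trace p n ((x :: 'a) ^ (p ^ k)) = abs_trace p n x"
proof (induction k)
  case (Suc k)
  have *: "abs_trace p n (y ^ p) = abs_trace p n y" for y :: 'a
  proof -
    have "abs_trace p n (y ^ p) = abs_trace p n y ^ p"
      unfolding abs_trace_def
      by (subst freshmans_dream_sum[OF CHAR_prime[where 'a = 'a]])
        (simp_all add: CHAR_eq_prime[OF prime_p card_UNIV] mult.commute flip: power_mult)
    also have "\<dots> = abs_trace p n y"
      using abs_trace_in_prime_subfield[OF prime_p card_UNIV]
        prime_subfield_iff[OF prime_p card_UNIV] by blast
    finally show ?thesis .
  qed
  have "abs_trace p n (x ^ (p ^ Suc k)) = abs_trace p n ((x ^ (p ^ k)) ^ p)"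
    by (simp add: mult.commute flip: power_mult)
  then show ?case using Suc * by simp
qed simp

text \<open>Otherwise, dividing by \<open>z\<close>, the trace would vanish on all
  \<open>p ^ n\<close> elements, although it is a linearized polynomial with at most
  \<open>p ^ (n - 1)\<close> roots.\<close>

lemma abs_trace_nondegenerate:
  assumes "\<And>x. abs_trace p n (z * x) = 0"
  shows "(z :: 'a) = 0"
proof (rule ccontr)
  assume "z \<noteq> 0"
  then have "abs_trace p n y = 0" for y :: 'a
    using assms[of "y / z"] by simp
  moreover have "abs_trace p n y = (\<Sum>i\<le>n - 1. 1 * y ^ (p ^ i))" for y :: 'a
    unfolding abs_trace_def using n_pos by (intro sum.cong) auto
  ultimately have "CARD('a) \<le> p ^ (n - 1)"
    using card_roots_linearized[of p "\<lambda>_. 1 :: 'a" "n - 1"] prime_ge_2_nat[OF prime_p] by simp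
  moreover have "p ^ (n - 1) < p ^ n"
    using n_pos prime_gt_1_nat[OF prime_p] by (intro power_strict_increasing) auto
  ultimately show False using card_UNIV by simp
qed

text \<open>The size of the image divides \<open>p ^ n\<close> and lies between 2 and
  \<open>p\<close>, so it is \<open>p\<close>. Hence \<open>f\<close> is onto the prime subfield,
  and its \<open>p\<close> fibres share the field equally.\<close>

lemma card_fiber_prime_subfield:
  fixes f :: "'a \<Rightarrow> 'a"
  assumes add: "\<And>x y. f (x + y) = f x + f y"
    and sub: "range f \<subseteq> prime_subfield" and nz: "f a \<noteq> 0" and c: "c \<in> prime_subfield"
  shows "card {x. f x = c} = p ^ (n - 1)"
proof -
  have card_sub: "card (prime_subfield :: 'a set) = p"
    using bij_betw_same_card[OF bij_betw_of_nat_prime_subfield[OF prime_p card_UNIV]] by simp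
  have prod: "p ^ n = card (range f) * card {x. f x = 0}"
    using card_range_kernel_additive[of f, OF add] card_UNIV by simp
  have le: "card (range f) \<le> p"
    using card_mono[OF _ sub] card_sub by simp
  have "f 0 = 0" using additive_minus[of f 0 0, OF add] by simp
  then have "card {0, f a} \<le> card (range f)"
    by (intro card_mono) (auto intro: range_eqI[of _ _ 0])
  then have ge: "card (range f) \<ge> 2" using nz by simp
  have "card (range f) dvd p ^ n" using prod by simp
  then obtain i where i: "card (range f) = p ^ i"
    using divides_primepow_nat[OF prime_p] by blast
  with ge have "i \<noteq> 0" by (cases i) auto
  then have "p dvd card (range f)" using i by simp
  then have card_range: "card (range f) = p"
    using le ge by (auto dest: dvd_imp_le)
  then have "range f = prime_subfield"
    using sub card_sub by (intro card_subset_eq) auto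
  then have "card {x. f x = c} = card {x. f x = 0}"
    using c by (intro card_fiber_additive add) simp
  moreover have "p * p ^ (n - 1) = p * card {x. f x = 0}"
    using prod card_range n_pos by (simp flip: power_Suc)
  ultimately show ?thesis using prime_gt_0_nat[OF prime_p] by simp
qed

section \<open>The profile of the power map and the orthogonal complement\<close>

lemma derivative_power_eq_ell:
  "derivative u (\<lambda>x :: 'a. x ^ (p ^ k + 1)) x = ell p k u x + u ^ (p ^ k + 1)"
  by (simp add: derivative_def ell_def frobenius_add algebra_simps)

lemma profile_entry_power:
  fixes u v j :: 'a
  assumes j: "j \<in> prime_subfield"
  shows "profile_entry p n (\<lambda>x. x ^ (p ^ k + 1)) u v j =
    (if v \<in> trace_perp p n (range (ell p k u))
     then if j = abs_trace p n (v * u ^ (p ^ k + 1))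
          then (int p - 1) * int p ^ (n - 1)
          else - (int p ^ (n - 1))
     else 0)"
proof -
  define t where "t = abs_trace p n (v * u ^ (p ^ k + 1))"
  define f where "f x = abs_trace p n (v * ell p k u x)" for x
  \<comment> \<open>The constant term of the derivative only shifts the index of the fibre by
    \<open>t\<close>.\<close>
  have set_eq: "{x. abs_trace p n (v * derivative u (\<lambda>x. x ^ (p ^ k + 1)) x) = j} =
      {x. f x = j - t}"
    by (simp only: derivative_power_eq_ell distrib_left abs_trace_add f_def t_def eq_diff_eq)
  show ?thesis
  proof (cases "v \<in> trace_perp p n (range (ell p k u))")
    case True
    \<comment> \<open>The fibre over \<open>j - t\<close> is now the whole field if
      \<open>j = t\<close> and empty otherwise.\<close>
    then have "f x = 0" for x by (auto simp: f_def trace_perp_def)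
    moreover have "int p ^ n = int p * int p ^ (n - 1)"
      using n_pos by (simp flip: power_Suc)
    ultimately show ?thesis
      using True card_UNIV unfolding profile_entry_def set_eq t_def[symmetric]
      by (auto simp: algebra_simps)
  next
    case False
    then obtain a where "f a \<noteq> 0" by (auto simp: f_def trace_perp_def)
    moreover have "f (x + y) = f x + f y" for x y
      by (simp add: f_def ell_linear(1)[OF prime_p card_UNIV] distrib_left abs_trace_add)
    moreover have "range f \<subseteq> prime_subfield"
      by (auto simp: f_def intro: abs_trace_in_prime_subfield[OF prime_p card_UNIV])
    moreover have "j - t \<in> prime_subfield"
    proof -
      have "t \<in> prime_subfield"
        unfolding t_def by (rule abs_trace_in_prime_subfield[OF prime_p card_UNIV])
      then show ?thesis
        using j additive_minus[of "\<lambda>x :: 'a. x ^ p" j t] frobenius_add[of _ _ 1]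
        by (simp add: prime_subfield_iff[OF prime_p card_UNIV])
    qed
    ultimately have "card {x. f x = j - t} = p ^ (n - 1)"
      by (intro card_fiber_prime_subfield)
    then show ?thesis using False unfolding profile_entry_def set_eq by simp
  qed
qed

text \<open>
  Applying the Frobenius power to the second summand,
  \<open>Tr (v ell_u(x)) = Tr ((v u + (v u\<^sup>q)\<^sup>q) x\<^sup>q)\<close> with \<open>q = p ^ k\<close>.
\<close>

lemma trace_perp_ell_iff:
  fixes u v :: 'a
  assumes u: "u \<noteq> 0"
  shows "v \<in> trace_perp p n (range (ell p k u)) \<longleftrightarrow>
    (v * u ^ (p ^ k + 1)) ^ (p ^ k) = - (v * u ^ (p ^ k + 1))"
proof -
  define q where "q = p ^ k"
  define a where "a = v * u + (v * u ^ q) ^ q"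
  have tr: "abs_trace p n (v * ell p k u x) = abs_trace p n (a * x ^ q)" for x
  proof -
    have "abs_trace p n (v * ell p k u x) =
        abs_trace p n (v * u * x ^ q) + abs_trace p n (v * u ^ q * x)"
      by (simp add: ell_def q_def distrib_left mult.assoc flip: abs_trace_add)
    also have "abs_trace p n (v * u ^ q * x) = abs_trace p n ((v * u ^ q * x) ^ q)"
      by (simp add: q_def abs_trace_frobenius)
    finally show ?thesis
      by (simp add: a_def distrib_right power_mult_distrib flip: abs_trace_add)
  qed
  have "v \<in> trace_perp p n (range (ell p k u)) \<longleftrightarrow> (\<forall>x. abs_trace p n (a * x ^ q) = 0)"
    by (simp add: trace_perp_def tr)
  \<comment> \<open>Frobenius is onto, so \<open>x ^ q\<close> runs through the whole field.\<close>
  also have "\<dots> \<longleftrightarrow> (\<forall>y. abs_trace p n (a * y) = 0)"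
    using surj_frobenius[of k] unfolding q_def by (metis surjD)
  also have "\<dots> \<longleftrightarrow> a = 0"
    using abs_trace_nondegenerate[of a] n_pos prime_gt_0_nat[OF prime_p]
    by (auto simp: abs_trace_def power_0_left)
  \<comment> \<open>The factor \<open>u ^ q\<close> turns \<open>a\<close> into
    \<open>w + w ^ q\<close> with \<open>w = v * u ^ (q + 1)\<close>.\<close>
  also have "\<dots> \<longleftrightarrow> a * u ^ q = 0" using u by simp
  also have "a * u ^ q = v * u ^ (q + 1) + (v * u ^ (q + 1)) ^ q"
    by (simp add: a_def algebra_simps power_mult_distrib)
  finally show ?thesis by (simp add: q_def add_eq_0_iff)
qed

section \<open>The equation \<open>w ^ (p ^ k) = - w\<close>\<close>

lemma frobenius_minus_imp_zero:
  assumes "odd p" and "odd (n div gcd k n)" and w: "(w :: 'a) ^ (p ^ k) = - w"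
  shows "w = 0"
proof -
  define r where "r = n div gcd k n"
  \<comment> \<open>As \<open>k * r\<close> is a multiple of \<open>n\<close>, the
    \<open>r\<close>-fold iterate of the \<open>p ^ k\<close>-th power map is the identity.\<close>
  have "k * r = n * (k div gcd k n)"
    unfolding r_def by (simp add: div_mult_swap mult.commute)
  then have "w = w ^ (p ^ (k * r))" by (simp only: power_card_power_same)
  also have "\<dots> = (- 1) ^ r * w"
    unfolding power_mult using \<open>odd p\<close> w by (intro power_iterate_minus) auto
  finally have "w = - w" using assms(2) by (simp add: r_def)
  \<comment> \<open>The characteristic is the odd prime \<open>p\<close>, so 2 is invertible and
    \<open>w\<close> must vanish.\<close>
  then have "w + w = 0" by (simp only: eq_neg_iff_add_eq_0)
  then have "of_nat 2 * w = 0" by (simp only: of_nat_numeral mult_2)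
  moreover have "(of_nat 2 :: 'a) \<noteq> 0"
  proof
    assume "(of_nat 2 :: 'a) = 0"
    then have "p dvd 2"
      by (simp only: of_nat_eq_0_iff_char_dvd CHAR_eq_prime[OF prime_p card_UNIV])
    then have "p = 2" by (rule primes_dvd_imp_eq[OF prime_p two_is_prime_nat])
    with \<open>odd p\<close> show False by simp
  qed
  ultimately show ?thesis by (metis mult_eq_0_iff)
qed

lemma frobenius_minus_iff_gcd:
  assumes "odd p" and even: "even (n div gcd k n)" and "k > 0"
  shows "(w :: 'a) ^ (p ^ k) = - w \<longleftrightarrow> w ^ (p ^ gcd k n) = - w"
proof -
  define e where "e = gcd k n"
  obtain k' r where k': "k = e * k'" and r: "n = e * r" and cop: "coprime k' r"
    unfolding e_def using \<open>k > 0\<close> gcd_coprime_exists[of k n] by (auto simp: mult.commute)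
  have e0: "e > 0" using \<open>k > 0\<close> by (simp add: e_def)
  have "n div gcd k n = r" unfolding e_def[symmetric] using r e0 by simp
  with even have "even r" by simp
  \<comment> \<open>A common factor 2 of \<open>k'\<close> and \<open>r\<close> would contradict
    coprimality.\<close>
  with cop have odd_k': "odd k'" by (metis coprime_common_divisor odd_one)
  \<comment> \<open>Bezout in the natural numbers: since \<open>p ^ (n * b)\<close>-th powers are
    trivial, the \<open>p ^ e\<close>-th power map is the \<open>a\<close>-fold iterate of the
    \<open>p ^ k\<close>-th one. Dividing by \<open>e\<close> and reducing modulo 2 then shows that
    \<open>a\<close> is odd.\<close>
  obtain a b where ab: "k * a = n * b + e"
    using bezout_nat[of k n] \<open>k > 0\<close> by (auto simp: e_def)
  have "k' * a = r * b + 1"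
  proof -
    have "e * (k' * a) = e * (r * b + 1)" using ab k' r by (simp add: algebra_simps)
    then show ?thesis using e0 unfolding mult_cancel1 by simp
  qed
  with \<open>even r\<close> have odd_a: "odd a" by (metis even_mult_iff odd_add odd_one)
  show ?thesis
  proof
    assume w: "w ^ (p ^ k) = - w"
    have "w ^ (p ^ e) = (w ^ (p ^ (n * b))) ^ (p ^ e)" by (simp add: power_card_power_same)
    also have "\<dots> = w ^ ((p ^ k) ^ a)" by (simp add: ab power_add flip: power_mult)
    also have "\<dots> = (- 1) ^ a * w" using \<open>odd p\<close> w by (intro power_iterate_minus) auto
    finally show "w ^ (p ^ gcd k n) = - w" using odd_a by (simp add: e_def)
  next
    assume w: "w ^ (p ^ gcd k n) = - w"
    \<comment> \<open>Conversely, the \<open>p ^ k\<close>-th power map is the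
      \<open>k'\<close>-fold iterate of the \<open>p ^ e\<close>-th one, and \<open>k'\<close> is
      odd.\<close>
    have "w ^ (p ^ k) = w ^ ((p ^ e) ^ k')" by (simp add: k' power_mult)
    also have "\<dots> = (- 1) ^ k' * w"
      using \<open>odd p\<close> w by (intro power_iterate_minus) (auto simp: e_def)
    finally show "w ^ (p ^ k) = - w" using odd_k' by simp
  qed
qed

text \<open>
  Both the kernel of \<open>x \<mapsto> x\<^sup>Q + x\<close> and its image consist of roots of linearized polynomials:
  for even \<open>r\<close> the alternating sum of the \<open>y ^ (Q ^ i)\<close>, \<open>i < r\<close>, telescopes to \<open>0\<close> on the
  image. The degree bounds \<open>Q\<close> and \<open>Q ^ (r - 1)\<close> multiply to the order of the field, so both
  are attained.
\<close>

lemma card_frobenius_minus: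
  assumes n: "n = e * r" and "even r"
  shows "card {w :: 'a. w ^ (p ^ e) = - w} = p ^ e"
proof -
  define Q where "Q = p ^ e"
  define f where "f x = x ^ Q + x" for x :: 'a
  define g where "g y = (\<Sum>i\<le>r - 1. (- 1) ^ i * y ^ (Q ^ i))" for y :: 'a
  have "e > 0" and r: "r > 0" using n n_pos by (auto intro: Nat.gr0I)
  then have "Q \<ge> 2 ^ 1"
    unfolding Q_def using prime_ge_2_nat[OF prime_p]
    by (intro order_trans[OF power_mono[of 2 p 1] power_increasing]) auto
  then have Q: "Q \<ge> 2" by simp
  have f_add: "f (x + y) = f x + f y" for x y
    by (simp add: f_def Q_def frobenius_add)
  have "{x. f x = 0} = {x. (\<Sum>i\<le>1. 1 * x ^ (Q ^ i)) = 0}"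
    by (simp add: f_def add.commute)
  then have ker_le: "card {x. f x = 0} \<le> Q"
    using card_roots_linearized[of Q "\<lambda>_. 1 :: 'a" 1] Q by simp
  have telescope: "(\<Sum>i<m. (- 1) ^ i * f x ^ (Q ^ i)) = x - (- 1) ^ m * x ^ (Q ^ m)" for m x
  proof (induction m)
    case (Suc m)
    have "f x ^ (Q ^ m) = x ^ (Q ^ Suc m) + x ^ (Q ^ m)"
      by (simp add: f_def Q_def frobenius_add flip: power_mult)
    then show ?case using Suc by (simp add: algebra_simps)
  qed simp
  have "g (f x) = 0" for x
  proof -
    have "g (f x) = (\<Sum>i<r. (- 1) ^ i * f x ^ (Q ^ i))"
      unfolding g_def using r by (intro sum.cong) auto
    also have "\<dots> = x - (- 1) ^ r * x ^ (Q ^ r)" by (rule telescope)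
    also have "\<dots> = x - x ^ (p ^ (n * 1))"
      using \<open>even r\<close> by (simp add: Q_def n flip: power_mult)
    finally show ?thesis by (simp only: power_card_power_same diff_self)
  qed
  then have "card (range f) \<le> card {y. g y = 0}"
    by (intro card_mono) auto
  also have "\<dots> \<le> Q ^ (r - 1)"
    unfolding g_def using Q by (intro card_roots_linearized) auto
  finally have im_le: "card (range f) \<le> Q ^ (r - 1)" .
  have "Q ^ (r - 1) * Q = p ^ n"
    using r by (simp add: Q_def n power_mult flip: power_Suc2)
  also have "\<dots> = card (range f) * card {x. f x = 0}"
    using card_range_kernel_additive[of f, OF f_add] card_UNIV by simp
  also have "\<dots> \<le> Q ^ (r - 1) * card {x. f x = 0}" using im_le by simp
  finally have "Q \<le> card {x. f x = 0}" using Q by simp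
  moreover have "{x. f x = 0} = {w. w ^ (p ^ e) = - w}"
    by (simp add: f_def Q_def eq_neg_iff_add_eq_0)
  ultimately show ?thesis using ker_le by (simp add: Q_def)
qed

section \<open>Shape of the profile and number of pairs\<close>

lemma profile_power_eq_map:
  fixes u v :: 'a
  assumes "v \<in> trace_perp p n (range (ell p k u))"
  obtains i where "i < p"
    and "profile p n (\<lambda>x. x ^ (p ^ k + 1)) u v =
      map (\<lambda>j. if j = i then (int p - 1) * int p ^ (n - 1) else - (int p ^ (n - 1))) [0..<p]"
proof -
  have bij: "bij_betw of_nat {..<p} (prime_subfield :: 'a set)"
    by (rule bij_betw_of_nat_prime_subfield[OF prime_p card_UNIV])
  \<comment> \<open>The exceptional position is the unique residue below \<open>p\<close>
    representing the trace value.\<close>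
  obtain i where i: "i < p" "of_nat i = abs_trace p n (v * u ^ (p ^ k + 1))"
    using bij abs_trace_in_prime_subfield[OF prime_p card_UNIV]
    unfolding bij_betw_def by (metis (no_types, lifting) imageE lessThan_iff)
  have eq_iff: "of_nat j = (of_nat i :: 'a) \<longleftrightarrow> j = i" if "j < p" for j
    using bij_betw_imp_inj_on[OF bij] i(1) that by (auto dest: inj_onD)
  show thesis
  proof (rule that[OF i(1)], unfold profile_def, rule map_cong[OF refl])
    fix j
    assume "j \<in> set [0..<p]"
    then have "of_nat j = (of_nat i :: 'a) \<longleftrightarrow> j = i" using eq_iff by simp
    moreover have "of_nat j \<in> (prime_subfield :: 'a set)" by (simp add: prime_subfield_def)
    ultimately show "profile_entry p n (\<lambda>x. x ^ (p ^ k + 1)) u v (of_nat j) =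
        (if j = i then (int p - 1) * int p ^ (n - 1) else - (int p ^ (n - 1)))"
      using assms by (simp only: profile_entry_power i(2)[symmetric] if_True)
  qed
qed

lemma profile_power_eq_zero_iff:
  fixes u v :: 'a
  shows "profile p n (\<lambda>x. x ^ (p ^ k + 1)) u v = replicate p 0 \<longleftrightarrow>
    v \<notin> trace_perp p n (range (ell p k u))"
proof (cases "v \<in> trace_perp p n (range (ell p k u))")
  case True
  then obtain i where i: "i < p" "profile p n (\<lambda>x. x ^ (p ^ k + 1)) u v =
      map (\<lambda>j. if j = i then (int p - 1) * int p ^ (n - 1) else - (int p ^ (n - 1))) [0..<p]"
    by (rule profile_power_eq_map)
  \<comment> \<open>The entry at \<open>i\<close> is \<open>(p - 1) * p ^ (n - 1)\<close>, which is
    nonzero because \<open>p > 1\<close>.\<close>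
  then have "profile p n (\<lambda>x. x ^ (p ^ k + 1)) u v ! i \<noteq> 0"
    using prime_gt_1_nat[OF prime_p] by simp
  with True i(1) show ?thesis by auto
next
  case False
  then have "profile_entry p n (\<lambda>x. x ^ (p ^ k + 1)) u v (of_nat j) = 0" for j
    by (simp only: profile_entry_power prime_subfield_def rangeI if_False)
  then have "profile p n (\<lambda>x. x ^ (p ^ k + 1)) u v = replicate p 0"
    by (simp only: profile_def map_replicate_const length_upt diff_zero)
  with False show ?thesis by blast
qed

lemma profile_power_perm:
  fixes u v :: 'a
  assumes "v \<in> trace_perp p n (range (ell p k u))"
  shows "profile p n (\<lambda>x. x ^ (p ^ k + 1)) u v <~~>
    ((int p - 1) * int p ^ (n - 1)) # replicate (p - 1) (- (int p ^ (n - 1)))"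
proof -
  define A B where "A = (int p - 1) * int p ^ (n - 1)" and "B = - (int p ^ (n - 1))"
  obtain i where i: "i < p" "profile p n (\<lambda>x. x ^ (p ^ k + 1)) u v =
      map (\<lambda>j. if j = i then A else B) [0..<p]"
    unfolding A_def B_def using assms by (rule profile_power_eq_map)
  \<comment> \<open>Splitting at \<open>i\<close> isolates the exceptional entry between two
    constant blocks, of total length \<open>p - 1\<close>.\<close>
  have "[0..<p] = [0..<i] @ i # [Suc i..<p]"
    using i(1) upt_add_eq_append[of 0 i "p - i"] by (simp add: upt_conv_Cons)
  moreover have "map (\<lambda>j. if j = i then A else B) [0..<i] = replicate i B"
    by (auto simp: list_eq_iff_nth_eq)
  moreover have "map (\<lambda>j. if j = i then A else B) [Suc i..<p] = replicate (p - Suc i) B"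
    by (auto simp: list_eq_iff_nth_eq)
  ultimately have "profile p n (\<lambda>x. x ^ (p ^ k + 1)) u v =
      replicate i B @ A # replicate (p - Suc i) B"
    unfolding i(2) by simp
  moreover have "p - 1 = i + (p - Suc i)" using i(1) by simp
  ultimately show ?thesis
    unfolding A_def[symmetric] B_def[symmetric] by (simp only: replicate_add) simp
qed

text \<open>Multiplication by the nonzero constant \<open>u ^ (p ^ k + 1)\<close> matches these
  \<open>v\<close> with the nonzero solutions of \<open>w ^ (p ^ k) = - w\<close>. The subtracted 1
  is the solution \<open>w = 0\<close>.\<close>

lemma card_trace_perp_ell_nonzero:
  fixes u :: 'a
  assumes "odd p" and even: "even (n div gcd k n)" and "k > 0" and u: "u \<noteq> 0"
  shows "card {v. v \<noteq> 0 \<and> v \<in> trace_perp p n (range (ell p k u))} = p ^ gcd k n - 1"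
proof -
  define e where "e = gcd k n"
  have "card {w :: 'a. w ^ (p ^ e) = - w} = p ^ e"
    using even by (intro card_frobenius_minus[of e "n div e"]) (auto simp: e_def)
  moreover have "{w :: 'a. w \<noteq> 0 \<and> w ^ (p ^ k) = - w} = {w. w ^ (p ^ e) = - w} - {0}"
    using frobenius_minus_iff_gcd[OF assms(1-3)] by (auto simp: e_def)
  moreover have "(0 :: 'a) \<in> {w. w ^ (p ^ e) = - w}"
    using prime_gt_0_nat[OF prime_p] by simp
  ultimately have card_w: "card {w :: 'a. w \<noteq> 0 \<and> w ^ (p ^ k) = - w} = p ^ e - 1"
    by (simp add: card_Diff_singleton)
  have "bij_betw (\<lambda>v. v * u ^ (p ^ k + 1))
      {v. v \<noteq> 0 \<and> v \<in> trace_perp p n (range (ell p k u))} {w. w \<noteq> 0 \<and> w ^ (p ^ k) = - w}"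
    by (rule bij_betw_byWitness[where f' = "\<lambda>w. w / u ^ (p ^ k + 1)"])
      (use u in \<open>auto simp: trace_perp_ell_iff[OF u] simp del: power_Suc power_add\<close>)
  from bij_betw_same_card[OF this] card_w show ?thesis by (simp add: e_def)
qed

end

theorem theorem4p8:
  fixes p n k e r :: nat
    and F :: "'a :: finite_field \<Rightarrow> 'a"
  assumes "prime p" and "odd p" and "n \<ge> 1" and "k \<ge> 1"
    and "CARD('a) = p ^ n"
    and F_def: "F = (\<lambda>x. x ^ (p ^ k + 1))"
    and e_def: "e = gcd k n"
    and r_def: "r = n div e"
  shows
    "(odd r \<longrightarrow> (\<forall>u v. u \<noteq> 0 \<and> v \<noteq> 0 \<longrightarrow> profile p n F u v = replicate p 0)) \<and>
     (even r \<longrightarrow>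
       (\<forall>u v. u \<noteq> 0 \<and> v \<noteq> 0 \<longrightarrow>
         (\<forall>j\<in>prime_subfield. profile_entry p n F u v j =
            (if v \<in> trace_perp p n (range (ell p k u))
             then if j = abs_trace p n (v * u ^ (p ^ k + 1))
                  then (int p - 1) * int p ^ (n - 1)
                  else - (int p ^ (n - 1))
             else 0))) \<and>
       card {(u :: 'a, v :: 'a). u \<noteq> 0 \<and> v \<noteq> 0} = (p ^ n - 1) ^ 2 \<and>
       card {(u, v). u \<noteq> 0 \<and> v \<noteq> 0 \<and> profile p n F u v = replicate p 0}
         = (p ^ n - 1) * (p ^ n - p ^ e) \<and>
       card {(u, v). u \<noteq> 0 \<and> v \<noteq> 0 \<and> profile p n F u v \<noteq> replicate p 0}
         = (p ^ n - 1) * (p ^ e - 1) \<and>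
       (\<forall>u v. u \<noteq> 0 \<and> v \<noteq> 0 \<and> profile p n F u v \<noteq> replicate p 0 \<longrightarrow>
          profile p n F u v <~~>
            ((int p - 1) * int p ^ (n - 1)) # replicate (p - 1) (- (int p ^ (n - 1)))))"
proof -
  note ctx = assms(1,5)
  have k: "k > 0" using assms(4) by simp
  note zero_iff = profile_power_eq_zero_iff[OF ctx, of k, folded F_def]
  \<comment> \<open>A \<open>v\<close> in the complement would force
    \<open>v * u ^ (p ^ k + 1) = 0\<close>, which is impossible for nonzero \<open>u\<close> and
    \<open>v\<close>.\<close>
  have zero_odd: "profile p n F u v = replicate p 0"
    if "odd r" "u \<noteq> 0" "v \<noteq> 0" for u v
    using that frobenius_minus_imp_zero[OF ctx assms(2), of k "v * u ^ (p ^ k + 1)"]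
    by (auto simp: zero_iff trace_perp_ell_iff[OF ctx] r_def e_def)
  let ?N = "- {0 :: 'a}"
  let ?perp = "\<lambda>u :: 'a. {v. v \<noteq> 0 \<and> v \<in> trace_perp p n (range (ell p k u))}"
  have cardN: "card ?N = p ^ n - 1" using assms(5) by (simp add: Compl_eq_Diff_UNIV)
  have pairs: "{(u :: 'a, v :: 'a). u \<noteq> 0 \<and> v \<noteq> 0} = ?N \<times> ?N" by auto
  \<comment> \<open>Written as dependent sums over \<open>u\<close>, both sets of pairs have fibres
    whose size does not depend on \<open>u\<close> when \<open>r\<close> is even.\<close>
  have nonzero: "{(u, v). u \<noteq> 0 \<and> v \<noteq> 0 \<and> profile p n F u v \<noteq> replicate p 0} = Sigma ?N ?perp"
    by (auto simp: zero_iff)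
  have zero: "{(u, v). u \<noteq> 0 \<and> v \<noteq> 0 \<and> profile p n F u v = replicate p 0} =
      Sigma ?N (\<lambda>u. ?N - ?perp u)"
    by (auto simp: zero_iff)
  have card_perp: "card (?perp u) = p ^ e - 1" if "even r" "u \<noteq> 0" for u
    using card_trace_perp_ell_nonzero[OF ctx assms(2) _ k] that by (simp add: r_def e_def)
  have card_nonperp: "card (?N - ?perp u) = p ^ n - p ^ e" if "even r" "u \<noteq> 0" for u
  proof -
    have "card (?N - ?perp u) = (p ^ n - 1) - (p ^ e - 1)"
      using card_perp[OF that] cardN by (subst card_Diff_subset) auto
    \<comment> \<open>The truncated differences combine correctly because
      \<open>p ^ e \<ge> 1\<close>.\<close>
    then show ?thesis using prime_gt_0_nat[OF assms(1)] by (simp add: Suc_leI)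
  qed
  show ?thesis
  proof (intro conjI impI allI ballI)
    show "card {(u :: 'a, v :: 'a). u \<noteq> 0 \<and> v \<noteq> 0} = (p ^ n - 1) ^ 2"
      by (simp only: pairs card_cartesian_product cardN power2_eq_square)
    show "card {(u, v). u \<noteq> 0 \<and> v \<noteq> 0 \<and> profile p n F u v = replicate p 0}
        = (p ^ n - 1) * (p ^ n - p ^ e)" if "even r"
      using that unfolding zero by (subst card_SigmaI) (auto simp: card_nonperp cardN)
    show "card {(u, v). u \<noteq> 0 \<and> v \<noteq> 0 \<and> profile p n F u v \<noteq> replicate p 0}
        = (p ^ n - 1) * (p ^ e - 1)" if "even r"
      using that unfolding nonzero by (subst card_SigmaI) (auto simp: card_perp cardN)
    show "profile p n F u v = replicate p 0" if "odd r" "u \<noteq> 0 \<and> v \<noteq> 0" for u v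
      using zero_odd that by blast
    show "profile_entry p n F u v j =
        (if v \<in> trace_perp p n (range (ell p k u))
         then if j = abs_trace p n (v * u ^ (p ^ k + 1))
              then (int p - 1) * int p ^ (n - 1)
              else - (int p ^ (n - 1))
         else 0)" if "j \<in> prime_subfield" for u v j
      unfolding F_def by (rule profile_entry_power[OF ctx that])
    show "profile p n F u v <~~>
        ((int p - 1) * int p ^ (n - 1)) # replicate (p - 1) (- (int p ^ (n - 1)))"
      if "u \<noteq> 0 \<and> v \<noteq> 0 \<and> profile p n F u v \<noteq> replicate p 0" for u v
      using profile_power_perm[OF ctx, of v k u, folded F_def] that zero_iff by blast
  qed
qed

end
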